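(* Let $\theta$ be a positive real number. Then for all integers $m\ge r>0$, $$\sum_{k=0}^{m-r}k!\,C(k+r-1,k)\,C(m-r,k)\,\theta_{(m-r-k)}=(\theta+r)_{(m-r)}.$$
   Context: Notation: $a_{(k)}=a(a+1)\cdots(a+k-1)$ for $k\ge1$, $a_{(0)}=1$; $C(m,n)=\frac{m!}{(m-n)!\,n!}$; $0!=1$. *)

theory Defs
  imports Complex_Main
begin

end

theory Submission
  imports Defs
begin

text \<open>Since k! C(k+r-1,k) = r(r+1)...(r+k-1), the sum is the Vandermonde identity for rising
  factorials, \<open>pochhammer_binomial_sum\<close>, applied to r and \<theta> with exponent
  m-r.\<close>

lemma fact_mult_binomial_eq_pochhammer:
  assumes "r > 0"
  shows "fact k * real ((k + r - 1) choose k) = pochhammer (real r) k"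
proof -
  \<comment> \<open>\<open>r > 0\<close> keeps the natural subtraction from truncating. In the
    generalized binomial, the product of k factors descending from k+r-1 ends at r.\<close>
  have "real ((k + r - 1) choose k) = (real k + real r - 1) gchoose k"
    using assms by (simp add: binomial_gbinomial of_nat_diff)
  then show ?thesis
    by (simp add: gbinomial_pochhammer' algebra_simps)
qed

theorem lemma4p2:
  fixes \<theta> :: real and m r :: nat
  assumes "\<theta> > 0" and "r > 0" and "m \<ge> r"
  shows "(\<Sum>k=0..m-r. fact k * real ((k + r - 1) choose k) * real ((m - r) choose k)
            * pochhammer \<theta> (m - r - k))
         = pochhammer (\<theta> + real r) (m - r)"
proof -
  have "pochhammer (\<theta> + real r) (m - r)
      = (\<Sum>k\<le>m-r. real ((m - r) choose k) * pochhammer (real r) k * pochhammer \<theta> (m - r - k))"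
    \<comment> \<open>Swapping the summands makes r the parameter that carries index k, leaving
      \<theta> with m-r-k.\<close>
    by (simp add: add.commute[of \<theta>] pochhammer_binomial_sum)
  then show ?thesis
    using assms(2) by (simp only: fact_mult_binomial_eq_pochhammer atMost_atLeast0 mult.commute[of "pochhammer (real r) _"])
qed

end
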